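(* Let $S:\mathbb{T}^1\to\mathbb{T}^1$ be a piecewise continuous map with a finite discontinuity set $H$. Let $(S_k)_{k\in\mathbb{N}}$ be a sequence of interval translation maps of $\mathbb{T}^1$ converging to $S$ uniformly on compact subsets of $\mathbb{T}^1\setminus H$. Assume that, for each $k$, $\mu_k$ is an $S_k$-invariant Borel probability measure, that the sequence $\mu_k$ converges weakly-$*$ to a measure $\mu^*$, and that $\mu^*(H)=0$. Then $\mu^*$ is $S$-invariant.
   Context: $\mathbb{T}^1=\mathbb{R}/\mathbb{Z}$. "Piecewise continuous with finite discontinuity set $H$" means that $H\subset\mathbb{T}^1$ is finite and $S$ is continuous at every point of $\mathbb{T}^1\setminus H$. An interval translation map (ITM) of the circle is a map $R:\mathbb{T}^1\to\mathbb{T}^1$ for which there are $n\in\mathbb{N}$, points $t_0,t_1,\ldots,t_n=t_0$ of $\mathbb{T}^1$ in cyclic order such that the half-open arcs $[t_j,t_{j+1})$, $j=0,\ldots,n-1$, are disjoint and cover $\mathbb{T}^1$, and real numbers $c_j$ such that $R(t)=t+c_j\bmod 1$ for $t\in[t_j,t_{j+1})$; the number $n$, the points $t_j$ and the shifts $c_j$ may depend on $k$ for the maps $S_k$. A Borel probability measure $\mu$ is invariant with respect to a map $R$ if $\mu(R^{-1}(A))=\mu(A)$ for every measurable set $A$. *)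

theory Defs
  imports "HOL-Probability.Probability"
begin

quotient_type circle = real / "\<lambda>x y. x - y \<in> \<int>"
  morphisms rep_circle to_circle
proof (rule equivpI)
  show "reflp (\<lambda>x y::real. x - y \<in> \<int>)"
    by (simp add: reflp_def)
  show "symp (\<lambda>x y::real. x - y \<in> \<int>)"
    by (rule sympI) (metis Ints_minus minus_diff_eq)
  show "transp (\<lambda>x y::real. x - y \<in> \<int>)"
  proof (rule transpI)
    fix x y z :: real
    assume "x - y \<in> \<int>" "y - z \<in> \<int>"
    then have "(x - y) + (y - z) \<in> \<int>" by (rule Ints_add)
    then show "x - z \<in> \<int>" by simp
  qed
qed

instantiation circle :: ab_group_add
begin

lift_definition zero_circle :: circle is 0 .

lift_definition plus_circle :: "circle \<Rightarrow> circle \<Rightarrow> circle" is "(+)"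
proof -
  fix x x' y y' :: real
  assume "x - x' \<in> \<int>" "y - y' \<in> \<int>"
  then have "(x - x') + (y - y') \<in> \<int>" by (rule Ints_add)
  then show "(x + y) - (x' + y') \<in> \<int>" by (simp add: algebra_simps)
qed

lift_definition uminus_circle :: "circle \<Rightarrow> circle" is uminus
proof -
  fix x x' :: real
  assume "x - x' \<in> \<int>"
  then have "- (x - x') \<in> \<int>" by (rule Ints_minus)
  then show "- x - - x' \<in> \<int>" by simp
qed

definition minus_circle :: "circle \<Rightarrow> circle \<Rightarrow> circle"
  where "minus_circle a b = a + - b"

instance
proof
  fix a b c :: circle
  show "a + b + c = a + (b + c)" by transfer simp
  show "a + b = b + a" by transfer simp
  show "0 + a = a" by transfer simp
  show "- a + a = 0" by transfer simp
  show "a - b = a + - b" by (rule minus_circle_def)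
qed

end

lemma to_circle_eq_iff: "to_circle x = to_circle y \<longleftrightarrow> x - y \<in> \<int>"
  by (fact circle.abs_eq_iff)

lemma to_circle_surj: "\<exists>x. a = to_circle x"
  by (rule exI[of _ "rep_circle a"]) (rule Quotient_abs_rep[OF Quotient_circle, symmetric])

text \<open>The quotient metric: the distance from \<open>x - y\<close> to the nearest integer.
  It induces the quotient topology, see \<open>open_circle_iff\<close> below.\<close>

definition int_dist :: "real \<Rightarrow> real"
  where "int_dist z = \<bar>z - of_int (round z)\<bar>"

lemma int_dist_le: "int_dist z \<le> \<bar>z - of_int m\<bar>"
  unfolding int_dist_def by (rule round_diff_minimal)

lemma int_dist_add_Ints:
  assumes "n \<in> \<int>"
  shows "int_dist (z + n) = int_dist z"
proof -
  from assms obtain k :: int where k: "n = of_int k" by (rule Ints_cases)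
  have "int_dist (z + n) \<le> \<bar>(z + n) - of_int (round z + k)\<bar>" by (rule int_dist_le)
  moreover have "int_dist z \<le> \<bar>z - of_int (round (z + n) - k)\<bar>" by (rule int_dist_le)
  ultimately show ?thesis unfolding int_dist_def k by (simp add: algebra_simps)
qed

instantiation circle :: metric_space
begin

lift_definition dist_circle :: "circle \<Rightarrow> circle \<Rightarrow> real" is "\<lambda>x y. int_dist (x - y)"
proof -
  fix x x' y y' :: real
  assume "x - x' \<in> \<int>" "y - y' \<in> \<int>"
  then have "(x - x') - (y - y') \<in> \<int>" by (rule Ints_diff)
  then have "int_dist ((x' - y') + ((x - x') - (y - y'))) = int_dist (x' - y')"
    by (rule int_dist_add_Ints)
  then show "int_dist (x - y) = int_dist (x' - y')" by (simp add: algebra_simps)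
qed

definition uniformity_circle :: "(circle \<times> circle) filter"
  where "uniformity_circle = (INF e\<in>{0 <..}. principal {(x, y). dist x y < e})"

definition open_circle :: "circle set \<Rightarrow> bool"
  where "open_circle U \<longleftrightarrow> (\<forall>x\<in>U. eventually (\<lambda>(x', y). x' = x \<longrightarrow> y \<in> U) uniformity)"

instance
proof
  fix a b c :: circle
  show "(dist a b = 0) = (a = b)"
  proof transfer
    fix x y :: real
    show "(int_dist (x - y) = 0) = (x - y \<in> \<int>)"
    proof
      assume "int_dist (x - y) = 0"
      then have "x - y = of_int (round (x - y))" by (simp add: int_dist_def)
      then show "x - y \<in> \<int>" by (metis Ints_of_int)
    next
      assume "x - y \<in> \<int>"
      then show "int_dist (x - y) = 0" by (auto simp: int_dist_def elim: Ints_cases)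
    qed
  qed
  show "dist a b \<le> dist a c + dist b c"
  proof transfer
    fix x y z :: real
    have "int_dist (x - y) \<le> \<bar>(x - y) - of_int (round (x - z) - round (y - z))\<bar>"
      by (rule int_dist_le)
    then show "int_dist (x - y) \<le> int_dist (x - z) + int_dist (y - z)"
      unfolding int_dist_def by simp
  qed
qed (simp_all add: uniformity_circle_def open_circle_def)

end

lemma dist_to_circle: "dist (to_circle x) (to_circle y) = int_dist (x - y)"
  by (fact dist_circle.abs_eq)

lemma open_circle_iff: "open U \<longleftrightarrow> open (to_circle -` U)"
proof
  assume U: "open U"
  show "open (to_circle -` U)"
    unfolding open_dist
  proof
    fix x assume "x \<in> to_circle -` U"
    then obtain e where e: "e > 0" "\<And>b. dist b (to_circle x) < e \<Longrightarrow> b \<in> U"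
      using U unfolding open_dist by auto
    have "y \<in> to_circle -` U" if "dist y x < e" for y
    proof -
      have "dist (to_circle y) (to_circle x) \<le> dist y x"
        unfolding dist_to_circle dist_real_def using int_dist_le[of "y - x" 0] by simp
      with that e show ?thesis by auto
    qed
    with e show "\<exists>e>0. \<forall>y. dist y x < e \<longrightarrow> y \<in> to_circle -` U" by blast
  qed
next
  assume U: "open (to_circle -` U)"
  show "open U"
    unfolding open_dist
  proof
    fix a assume a: "a \<in> U"
    obtain x where x: "a = to_circle x" using to_circle_surj by blast
    obtain e where e: "e > 0" "\<And>y. dist y x < e \<Longrightarrow> to_circle y \<in> U"
      using U a x unfolding open_dist by force
    have "b \<in> U" if b: "dist b a < e" for b
    proof -
      obtain y where y: "b = to_circle y" using to_circle_surj by blast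
      define y' where "y' = y - of_int (round (y - x))"
      have "to_circle y' = b" unfolding y y'_def to_circle_eq_iff by simp
      moreover have "dist y' x < e"
        using b unfolding x y dist_to_circle int_dist_def dist_real_def y'_def
        by (simp add: algebra_simps)
      ultimately show ?thesis using e by auto
    qed
    with e show "\<exists>e>0. \<forall>b. dist b a < e \<longrightarrow> b \<in> U" by blast
  qed
qed

text \<open>\<open>ccw a b\<close> is the length in \<open>[0, 1)\<close> of the positively oriented path from \<open>a\<close> to \<open>b\<close>.\<close>

lift_definition ccw :: "circle \<Rightarrow> circle \<Rightarrow> real" is "\<lambda>x y. frac (y - x)"
proof -
  fix x x' y y' :: real
  assume "x - x' \<in> \<int>" "y - y' \<in> \<int>"
  then have "(y - y') - (x - x') \<in> \<int>" by (auto intro: Ints_diff)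
  then obtain k :: int where "(y - y') - (x - x') = of_int k" by (rule Ints_cases)
  then have "y - x = (y' - x') + of_int k" by simp
  then show "frac (y - x) = frac (y' - x')" by (simp add: frac_def)
qed

text \<open>The half-open arc \<open>[a, b)\<close>. For \<open>a = b\<close> it is the full turn, which is what a
  partition with the single point \<open>t 0 = t 1\<close> requires.\<close>

definition arc_co :: "circle \<Rightarrow> circle \<Rightarrow> circle set"
  where "arc_co a b = (if a = b then UNIV else {x. ccw a x < ccw a b})"

text \<open>The points \<open>t 0, \<dots>, t (n - 1)\<close> are distinct and in positive cyclic order.\<close>

definition cyclically_ordered :: "nat \<Rightarrow> (nat \<Rightarrow> circle) \<Rightarrow> bool"
  where "cyclically_ordered n t \<longleftrightarrow> strict_mono_on {..<n} (\<lambda>j. ccw (t 0) (t j))"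

definition interval_translation_map :: "(circle \<Rightarrow> circle) \<Rightarrow> bool"
  where "interval_translation_map R \<longleftrightarrow>
    (\<exists>(n::nat) (t :: nat \<Rightarrow> circle) (c :: nat \<Rightarrow> real).
       n \<ge> 1 \<and> t n = t 0 \<and> cyclically_ordered n t \<and>
       disjoint_family_on (\<lambda>j. arc_co (t j) (t (Suc j))) {..<n} \<and>
       (\<Union>j<n. arc_co (t j) (t (Suc j))) = UNIV \<and>
       (\<forall>j<n. \<forall>x \<in> arc_co (t j) (t (Suc j)). R x = x + to_circle (c j)))"

definition piecewise_continuous :: "(circle \<Rightarrow> circle) \<Rightarrow> circle set \<Rightarrow> bool"
  where "piecewise_continuous S H \<longleftrightarrow> finite H \<and> (\<forall>x. x \<notin> H \<longrightarrow> isCont S x)"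

text \<open>Measurability of \<open>R\<close>, which is implicit in speaking of \<open>\<mu> (R -` A)\<close>, is demanded
  explicitly, since \<open>emeasure\<close> is \<open>0\<close> on non-measurable sets.\<close>

definition invariant_measure :: "circle measure \<Rightarrow> (circle \<Rightarrow> circle) \<Rightarrow> bool"
  where "invariant_measure \<mu> R \<longleftrightarrow>
    R \<in> measurable \<mu> \<mu> \<and>
    (\<forall>A \<in> sets \<mu>. emeasure \<mu> (R -` A \<inter> space \<mu>) = emeasure \<mu> A)"

definition weak_star_conv :: "(nat \<Rightarrow> circle measure) \<Rightarrow> circle measure \<Rightarrow> bool"
  where "weak_star_conv \<mu> \<nu> \<longleftrightarrow>
    (\<forall>f :: circle \<Rightarrow> real. continuous_on UNIV f \<longrightarrow>
       (\<lambda>k. integral\<^sup>L (\<mu> k) f) \<longlonglongrightarrow> integral\<^sup>L \<nu> f)"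

end

theory Submission
  imports Defs
begin

text \<open>For continuous \<open>f\<close> and a continuous cutoff \<open>0 \<le> g \<le> 1\<close> vanishing on \<open>H\<close>, the function
  \<open>(f \<circ> S) \<cdot> g\<close> is continuous and \<open>(f \<circ> S\<^sub>k) \<cdot> g\<close> converges to it uniformly on the whole circle.
  Since \<open>\<integral> f \<circ> S\<^sub>k d\<mu>\<^sub>k = \<integral> f d\<mu>\<^sub>k\<close>, weak convergence bounds the difference of \<open>\<integral> f d\<mu>*\<close> and
  \<open>\<integral> (f \<circ> S) \<cdot> g d\<mu>*\<close> by \<open>sup \<bar>f\<bar> \<cdot> \<integral> (1 - g) d\<mu>*\<close>. Letting \<open>g\<close> increase to the indicator of the
  complement of the null set \<open>H\<close> yields \<open>\<integral> f d\<mu>* = \<integral> f \<circ> S d\<mu>*\<close>, and continuous functions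
  determine a finite Borel measure on a metric space.\<close>

section \<open>Finite Borel measures are determined by bounded continuous functions\<close>

text \<open>The integrands are 1 on \<open>C\<close>, and off \<open>C\<close> they are eventually 0
  because the distance to a closed set is positive there; dominated convergence with bound 1
  applies. The empty set is excluded because \<open>infdist\<close> to it is 0 by convention, which
  would make every integrand constantly 1.\<close>

lemma closed_measure_tendsto:
  fixes M :: "'a::metric_space measure"
  assumes "finite_measure M" and [measurable_cong]: "sets M = sets borel"
    and "closed C" "C \<noteq> {}"
  shows "(\<lambda>m. \<integral>x. max 0 (1 - real m * infdist x C) \<partial>M) \<longlonglongrightarrow> measure M C"
proof -
  interpret finite_measure M by fact
  have [measurable]: "C \<in> sets M"
    using assms by simp
  have cont: "continuous_on UNIV (\<lambda>x. max 0 (1 - real m * infdist x C))" for m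
    by (intro continuous_intros)
  have "(\<lambda>m. \<integral>x. max 0 (1 - real m * infdist x C) \<partial>M) \<longlonglongrightarrow> (\<integral>x. indicator C x \<partial>M)"
  proof (rule integral_dominated_convergence[where w = "\<lambda>_. 1"])
    show "indicator C \<in> borel_measurable M"
      by measurable
    show "(\<lambda>x. max 0 (1 - real m * infdist x C)) \<in> borel_measurable M" for m
      using borel_measurable_continuous_onI[OF cont] by measurable
    show "AE x in M. norm (max 0 (1 - real m * infdist x C)) \<le> 1" for m
      by (simp add: infdist_nonneg)
    have "(\<lambda>m. max 0 (1 - real m * infdist x C)) \<longlonglongrightarrow> indicator C x" for x
    proof (cases "x \<in> C")
      case False
      then have pos: "infdist x C > 0"
        using assms in_closed_iff_infdist_zero[of C x] infdist_nonneg[of x C] by force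
      obtain n :: nat where n: "1 / infdist x C < real n"
        using reals_Archimedean2 by blast
      have "max 0 (1 - real m * infdist x C) = 0" if "m \<ge> n" for m
      proof -
        have "1 < real n * infdist x C"
          using n pos by (simp add: field_simps)
        also have "\<dots> \<le> real m * infdist x C"
          using that pos by simp
        finally show ?thesis by simp
      qed
      then have "eventually (\<lambda>m. max 0 (1 - real m * infdist x C) = 0) sequentially"
        by (auto simp: eventually_sequentially)
      then show ?thesis
        using False by (simp add: tendsto_eventually)
    qed simp
    then show "AE x in M. (\<lambda>m. max 0 (1 - real m * infdist x C)) \<longlonglongrightarrow> indicator C x"
      by simp
  qed simp
  then show ?thesis
    by simp
qed

text \<open>Closed sets form an intersection-stable generator of the Borel sets, and the measure of
  each is a limit of integrals of bounded continuous functions, on which \<open>M\<close> and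
  \<open>N\<close> agree.\<close>

lemma finite_borel_measure_eqI:
  fixes M N :: "'a::metric_space measure"
  assumes M: "finite_measure M" "sets M = sets borel"
    and N: "finite_measure N" "sets N = sets borel"
    and eq: "\<And>f :: 'a \<Rightarrow> real. continuous_on UNIV f \<Longrightarrow> bounded (range f) \<Longrightarrow>
      integral\<^sup>L M f = integral\<^sup>L N f"
  shows "M = N"
proof (rule measure_eqI_generator_eq[where E = "Collect closed" and \<Omega> = UNIV and A = "\<lambda>_. UNIV"])
  show "Int_stable (Collect closed :: 'a set set)"
    by (auto simp: Int_stable_def)
  show "emeasure M C = emeasure N C" if C: "C \<in> Collect closed" for C
  proof (cases "C = {}")
    case False
    define \<phi> where "\<phi> m x = max 0 (1 - real m * infdist x C)" for m x
    have "continuous_on UNIV (\<phi> m)" for m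
      unfolding \<phi>_def by (intro continuous_intros)
    moreover have "bounded (range (\<phi> m))" for m
      by (rule boundedI[of _ 1]) (auto simp: \<phi>_def infdist_nonneg)
    ultimately have "integral\<^sup>L M (\<phi> m) = integral\<^sup>L N (\<phi> m)" for m
      by (rule eq)
    moreover have "(\<lambda>m. integral\<^sup>L M (\<phi> m)) \<longlonglongrightarrow> measure M C"
      "(\<lambda>m. integral\<^sup>L N (\<phi> m)) \<longlonglongrightarrow> measure N C"
      unfolding \<phi>_def using closed_measure_tendsto M N C False by blast+
    ultimately have "measure M C = measure N C"
      using LIMSEQ_unique by auto
    then show ?thesis
      by (simp add: finite_measure.emeasure_eq_measure M N)
  qed simp
  show "sets M = sigma_sets UNIV (Collect closed)" "sets N = sigma_sets UNIV (Collect closed)"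
    by (simp_all add: M N borel_eq_closed)
  show "emeasure M UNIV \<noteq> \<infinity>"
    using finite_measure.emeasure_finite[OF M(1)] by simp
qed auto

section \<open>Functions with exceptional points and their products with cutoffs\<close>

text \<open>The preimage of an open set is an open part off \<open>H\<close> together with a finite,
  hence closed, part inside \<open>H\<close>.\<close>

lemma borel_measurable_off_finite:
  fixes S :: "'a::t2_space \<Rightarrow> 'b::topological_space"
  assumes "finite H" "\<And>x. x \<notin> H \<Longrightarrow> isCont S x"
  shows "S \<in> borel_measurable borel"
proof (rule borel_measurableI)
  fix U :: "'b set"
  assume "open U"
  have "open (- H)"
    using assms(1) by (simp add: finite_imp_closed open_Compl)
  moreover have "continuous_on (- H) S"
    using assms(2) by (simp add: continuous_at_imp_continuous_on)
  ultimately have "open (S -` U \<inter> - H)"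
    using \<open>open U\<close> continuous_open_preimage[of "- H" S U] by (simp add: Int_commute)
  moreover have "finite (S -` U \<inter> H)"
    using assms(1) by simp
  ultimately have "(S -` U \<inter> - H) \<union> (S -` U \<inter> H) \<in> sets borel"
    by (intro sets.Un) (auto intro: borel_open borel_closed finite_imp_closed)
  moreover have "(S -` U \<inter> - H) \<union> (S -` U \<inter> H) = S -` U \<inter> space borel"
    by auto
  ultimately show "S -` U \<inter> space borel \<in> sets borel"
    by simp
qed

text \<open>Off \<open>H\<close> both factors are continuous. At a point of \<open>H\<close> the
  factor \<open>F\<close> may jump, but it is bounded while \<open>g\<close> tends to 0, so the
  product tends to its value 0.\<close>

lemma continuous_mult_cutoff:
  fixes F g :: "'a::t2_space \<Rightarrow> real"
  assumes "\<And>x. x \<notin> H \<Longrightarrow> isCont F x" "\<And>x. \<bar>F x\<bar> \<le> B"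
    and g: "continuous_on UNIV g" "\<And>x. x \<in> H \<Longrightarrow> g x = 0"
  shows "continuous_on UNIV (\<lambda>x. F x * g x)"
proof (rule continuous_at_imp_continuous_on, rule ballI)
  fix x
  have gx: "isCont g x"
    using g(1) by (simp add: continuous_on_eq_continuous_at)
  show "isCont (\<lambda>x. F x * g x) x"
  proof (cases "x \<in> H")
    case True
    have "(g \<longlongrightarrow> 0) (at x)"
      using gx g(2)[OF True] by (simp add: isCont_def)
    then have "((\<lambda>y. F y * g y) \<longlongrightarrow> 0) (at x)"
      by (rule tendsto_0_le[where K = B])
        (auto simp: abs_mult mult.commute[of _ B] intro!: always_eventually mult_right_mono assms(2))
    then show ?thesis
      using g(2)[OF True] by (simp add: isCont_def)
  qed (intro continuous_intros assms(1) gx)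
qed

text \<open>The space is split at a small level of \<open>g\<close>. Where \<open>g\<close> is at
  least that level, the set is compact and avoids \<open>H\<close>, so the assumed convergence
  applies; elsewhere the small factor \<open>g\<close> beats the crude bound \<open>2 * B\<close> on
  the difference.\<close>

lemma uniform_limit_mult_cutoff:
  fixes F :: "'a::metric_space \<Rightarrow> real" and g :: "'a \<Rightarrow> real"
  assumes cpt: "compact (UNIV :: 'a set)"
    and bd: "\<And>k x. \<bar>Fk k x\<bar> \<le> B" "\<And>x. \<bar>F x\<bar> \<le> B"
    and lim: "\<And>K. compact K \<Longrightarrow> K \<subseteq> - H \<Longrightarrow> uniform_limit K Fk F sequentially"
    and g: "continuous_on UNIV g" "\<And>x. x \<in> H \<Longrightarrow> g x = 0" "\<And>x. 0 \<le> g x" "\<And>x. g x \<le> 1"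
  shows "uniform_limit UNIV (\<lambda>k x. Fk k x * g x) (\<lambda>x. F x * g x) sequentially"
proof (rule uniform_limitI)
  fix e :: real
  assume e: "e > 0"
  have B: "0 \<le> B"
    using bd(2) abs_ge_zero order_trans by blast
  \<comment> \<open>The summand 1 keeps the denominator positive when \<open>B = 0\<close> and makes
    \<open>2 * B * \<delta> < e\<close> strict.\<close>
  define \<delta> where "\<delta> = e / (2 * B + 1)"
  have \<delta>: "\<delta> > 0" "2 * B * \<delta> < e"
    using e B by (simp_all add: \<delta>_def field_simps)
  define K where "K = {x. \<delta> \<le> g x}"
  have "closed K"
    unfolding K_def using g(1) by (intro closed_Collect_le continuous_intros)
  then have "compact K"
    using compact_Int_closed[OF cpt] by simp
  moreover have "K \<subseteq> - H"
    using g(2) \<delta> by (auto simp: K_def)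
  ultimately have "\<forall>\<^sub>F k in sequentially. \<forall>x\<in>K. dist (Fk k x) (F x) < e"
    using lim e by (auto simp: uniform_limit_iff)
  then show "\<forall>\<^sub>F k in sequentially. \<forall>x\<in>UNIV. dist (Fk k x * g x) (F x * g x) < e"
  proof (eventually_elim, intro ballI)
    fix k x
    assume near: "\<forall>x\<in>K. dist (Fk k x) (F x) < e"
    have eq: "dist (Fk k x * g x) (F x * g x) = \<bar>Fk k x - F x\<bar> * g x"
      using g(3) by (simp add: dist_real_def abs_mult flip: left_diff_distrib)
    show "dist (Fk k x * g x) (F x * g x) < e"
    proof (cases "x \<in> K")
      case True
      have "\<bar>Fk k x - F x\<bar> * g x \<le> \<bar>Fk k x - F x\<bar>"
        using g(4)[of x] g(3)[of x] by (simp add: mult_left_le)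
      then show ?thesis
        using near True eq by (fastforce simp: dist_real_def)
    next
      case False
      have "\<bar>Fk k x - F x\<bar> \<le> 2 * B"
        using bd(1)[of k x] bd(2)[of x] by linarith
      then have "\<bar>Fk k x - F x\<bar> * g x \<le> 2 * B * \<delta>"
        using False g(3)[of x] by (intro mult_mono) (auto simp: K_def B)
      then show ?thesis
        using \<delta> eq by simp
    qed
  qed
qed

section \<open>Invariance as equality with the push-forward\<close>

lemma integrable_bounded:
  fixes f :: "'a::topological_space \<Rightarrow> real"
  assumes "finite_measure M" "sets M = sets borel" "f \<in> borel_measurable borel" "\<And>x. \<bar>f x\<bar> \<le> B"
  shows "integrable M f"
proof (rule finite_measure.integrable_const_bound[OF assms(1)])
  show "f \<in> borel_measurable M"
    using assms(2,3) measurable_cong_sets by blast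
  show "AE x in M. norm (f x) \<le> B"
    using assms(4) by simp
qed

text \<open>As an equality of measures, invariance can be proved by comparing integrals of
  continuous functions and used as a change of variables.\<close>

lemma invariant_measure_iff_distr:
  assumes "sets \<mu> = sets borel"
  shows "invariant_measure \<mu> R \<longleftrightarrow> R \<in> borel_measurable borel \<and> distr \<mu> borel R = \<mu>"
proof -
  have meas: "R \<in> measurable \<mu> \<mu> \<longleftrightarrow> R \<in> borel_measurable borel"
    using measurable_cong_sets[OF assms assms] by simp
  have "(\<forall>A\<in>sets \<mu>. emeasure \<mu> (R -` A \<inter> space \<mu>) = emeasure \<mu> A) \<longleftrightarrow> distr \<mu> borel R = \<mu>"
    if "R \<in> borel_measurable borel"
  proof -
    have R: "R \<in> measurable \<mu> borel"
      using that measurable_cong_sets[OF assms refl] by blast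
    show ?thesis
    proof
      assume *: "\<forall>A\<in>sets \<mu>. emeasure \<mu> (R -` A \<inter> space \<mu>) = emeasure \<mu> A"
      show "distr \<mu> borel R = \<mu>"
        by (rule measure_eqI) (use * R assms in \<open>simp_all add: emeasure_distr\<close>)
    next
      assume *: "distr \<mu> borel R = \<mu>"
      show "\<forall>A\<in>sets \<mu>. emeasure \<mu> (R -` A \<inter> space \<mu>) = emeasure \<mu> A"
      proof
        fix A
        assume "A \<in> sets \<mu>"
        then have "emeasure (distr \<mu> borel R) A = emeasure \<mu> (R -` A \<inter> space \<mu>)"
          using R assms by (simp add: emeasure_distr)
        then show "emeasure \<mu> (R -` A \<inter> space \<mu>) = emeasure \<mu> A"
          using * by simp
      qed
    qed
  qed
  then show ?thesis
    unfolding invariant_measure_def meas by blast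
qed

lemma integral_invariant_measure:
  fixes f :: "circle \<Rightarrow> real"
  assumes "sets \<mu> = sets borel" "invariant_measure \<mu> R" "f \<in> borel_measurable borel"
  shows "(\<integral>x. f (R x) \<partial>\<mu>) = integral\<^sup>L \<mu> f"
proof -
  have "R \<in> borel_measurable borel" and distr: "distr \<mu> borel R = \<mu>"
    using assms invariant_measure_iff_distr by auto
  then have "R \<in> measurable \<mu> borel"
    using measurable_cong_sets[OF assms(1) refl] by blast
  from integral_distr[OF this assms(3)] show ?thesis
    by (simp add: distr)
qed

section \<open>The estimate with a fixed cutoff on the circle\<close>

text \<open>The circle is the continuous image of a unit interval. Compactness makes test functions
  uniformly continuous and closed superlevel sets of a cutoff compact.\<close>

lemma compact_UNIV_circle: "compact (UNIV :: circle set)"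
proof -
  have "continuous_on UNIV to_circle"
    by (subst continuous_on_open_vimage) (auto simp: open_circle_iff)
  then have "compact (to_circle ` {0..1})"
    by (intro compact_continuous_image) (auto intro: continuous_on_subset)
  moreover have "to_circle ` {0..1} = UNIV"
  proof -
    have "a \<in> to_circle ` {0..1}" for a
    proof -
      obtain x where x: "a = to_circle x"
        using to_circle_surj by blast
      have "a = to_circle (frac x)"
        unfolding x to_circle_eq_iff by (simp add: frac_def)
      moreover have "frac x \<in> {0..1}"
        using frac_ge_0 frac_lt_1[of x] by (auto intro: less_imp_le)
      ultimately show ?thesis
        by blast
    qed
    then show ?thesis
      by blast
  qed
  ultimately show ?thesis
    by simp
qed

text \<open>The same inequality holds for each \<open>\<mu> k\<close> with \<open>Sk k\<close> in
  place of \<open>S\<close>: by invariance \<open>f\<close> and \<open>f\<close> composed with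
  \<open>Sk k\<close> have the same integral, and inserting the factor \<open>g\<close> costs at
  most \<open>B\<close> times the integral of \<open>1 - g\<close>. Every term then converges as
  \<open>k\<close> grows.\<close>

lemma cutoff_estimate:
  fixes f g :: "circle \<Rightarrow> real"
  assumes S: "S \<in> borel_measurable borel" "\<And>x. x \<notin> H \<Longrightarrow> isCont S x"
    and lim: "\<And>K. compact K \<Longrightarrow> K \<subseteq> - H \<Longrightarrow> uniform_limit K Sk S sequentially"
    and \<mu>: "\<And>k. sets (\<mu> k) = sets borel" "\<And>k. prob_space (\<mu> k)"
      "\<And>k. invariant_measure (\<mu> k) (Sk k)"
    and conv: "weak_star_conv \<mu> \<nu>"
    and \<nu>: "sets \<nu> = sets borel" "finite_measure \<nu>"
    and f: "continuous_on UNIV f" "\<And>x. \<bar>f x\<bar> \<le> B"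
    and g: "continuous_on UNIV g" "\<And>x. x \<in> H \<Longrightarrow> g x = 0" "\<And>x. 0 \<le> g x" "\<And>x. g x \<le> 1"
  shows "\<bar>integral\<^sup>L \<nu> f - (\<integral>x. f (S x) * g x \<partial>\<nu>)\<bar> \<le> B * (\<integral>x. 1 - g x \<partial>\<nu>)"
proof -
  have fin: "finite_measure (\<mu> k)" for k
    using \<mu>(2) by (simp add: prob_space_def)
  have B: "0 \<le> B"
    using f(2) abs_ge_zero order_trans by blast
  have fm [measurable]: "f \<in> borel_measurable borel" and gm [measurable]: "g \<in> borel_measurable borel"
    using f(1) g(1) by (auto intro: borel_measurable_continuous_onI)
  note S(1) [measurable]
  \<comment> \<open>Measurability is read off from the invariance of \<open>\<mu> k\<close>.\<close>
  have [measurable]: "Sk k \<in> borel_measurable borel" for k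
    using \<mu> invariant_measure_iff_distr by blast
  have fg: "\<bar>f y * g x\<bar> \<le> B" for x y
    using mult_mono[OF f(2)[of y] g(4)[of x]] g(3)[of x] B by (simp add: abs_mult)
  have lim_f: "(\<lambda>k. integral\<^sup>L (\<mu> k) f) \<longlonglongrightarrow> integral\<^sup>L \<nu> f"
    using conv f(1) by (auto simp: weak_star_conv_def)
  have lim_g: "(\<lambda>k. \<integral>x. 1 - g x \<partial>\<mu> k) \<longlonglongrightarrow> (\<integral>x. 1 - g x \<partial>\<nu>)"
    using conv g(1) by (auto simp: weak_star_conv_def intro!: continuous_intros)
  have "isCont f x" for x
    using f(1) by (simp add: continuous_on_eq_continuous_at)
  then have "isCont (\<lambda>x. f (S x)) x" if "x \<notin> H" for x
    using isCont_o2[OF S(2)[OF that]] by blast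
  \<comment> \<open>The cutoff removes the discontinuities of \<open>S\<close>, which makes the
    product admissible as a test function for weak convergence.\<close>
  then have "continuous_on UNIV (\<lambda>x. f (S x) * g x)"
    by (rule continuous_mult_cutoff[where F = "\<lambda>x. f (S x)" and B = B and H = H]) (use f g in auto)
  then have lim_S: "(\<lambda>k. \<integral>x. f (S x) * g x \<partial>\<mu> k) \<longlonglongrightarrow> (\<integral>x. f (S x) * g x \<partial>\<nu>)"
    using conv by (auto simp: weak_star_conv_def)
  have unif: "uniform_limit UNIV (\<lambda>k x. f (Sk k x) * g x) (\<lambda>x. f (S x) * g x) sequentially"
  proof (rule uniform_limit_mult_cutoff[where B = B and H = H and F = "\<lambda>x. f (S x)"
        and Fk = "\<lambda>k x. f (Sk k x)"])
    fix K
    assume "compact K" "K \<subseteq> - H"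
    \<comment> \<open>Composition with \<open>f\<close> on the outside preserves uniform convergence
      because \<open>f\<close> is uniformly continuous.\<close>
    moreover have "uniformly_continuous_on UNIV f"
      using f(1) compact_UNIV_circle by (rule compact_uniformly_continuous)
    ultimately show "uniform_limit K (\<lambda>k x. f (Sk k x)) (\<lambda>x. f (S x)) sequentially"
      using lim uniform_limit_compose[where X = K and g = Sk and l = S and U = UNIV and f = f] by (simp add: o_def)
  qed (use f g compact_UNIV_circle in auto)
  have int_S: "integrable (\<mu> k) (\<lambda>x. f (S x) * g x)" and
    int_Sk: "integrable (\<mu> k) (\<lambda>x. f (Sk k x) * g x)" for k
    by (rule integrable_bounded[where B = B]; use fin \<mu>(1) fg in simp)+
  \<comment> \<open>Integrand and measure both vary with \<open>k\<close>, so weak convergence alone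
    does not suffice. Uniform closeness of the integrands does, since each \<open>\<mu> k\<close>
    has total mass 1.\<close>
  have lim_diff: "(\<lambda>k. (\<integral>x. f (Sk k x) * g x \<partial>\<mu> k) - (\<integral>x. f (S x) * g x \<partial>\<mu> k)) \<longlonglongrightarrow> 0"
  proof (rule tendstoI)
    fix e :: real
    assume e: "e > 0"
    then have "\<forall>\<^sub>F k in sequentially. \<forall>x\<in>UNIV. dist (f (Sk k x) * g x) (f (S x) * g x) < e / 2"
      using unif by (intro uniform_limitD) auto
    then show "\<forall>\<^sub>F k in sequentially.
      dist ((\<integral>x. f (Sk k x) * g x \<partial>\<mu> k) - (\<integral>x. f (S x) * g x \<partial>\<mu> k)) 0 < e"
    proof eventually_elim
      case (elim k)
      interpret prob_space "\<mu> k" by (rule \<mu>)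
      have "\<bar>\<integral>x. f (Sk k x) * g x - f (S x) * g x \<partial>\<mu> k\<bar>
        \<le> (\<integral>x. \<bar>f (Sk k x) * g x - f (S x) * g x\<bar> \<partial>\<mu> k)"
        by (rule integral_abs_bound)
      also have "\<dots> \<le> (\<integral>x. e / 2 \<partial>\<mu> k)"
        using elim int_S int_Sk
        by (intro integral_mono) (auto simp: dist_real_def intro: less_imp_le)
      also have "\<dots> < e"
        using e by (simp add: prob_space)
      finally show ?case
        using int_S int_Sk by (simp add: dist_real_def)
    qed
  qed
  have "\<bar>integral\<^sup>L (\<mu> k) f - (\<integral>x. f (Sk k x) * g x \<partial>\<mu> k)\<bar> \<le> B * (\<integral>x. 1 - g x \<partial>\<mu> k)" for k
  proof -
    have int_f: "integrable (\<mu> k) (\<lambda>x. f (Sk k x))"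
      by (rule integrable_bounded[where B = B]; use fin \<mu>(1) f in simp)
    have "integrable (\<mu> k) (\<lambda>x. 1 - g x)"
      by (rule integrable_bounded[where B = 1]; use fin \<mu>(1) g in simp)
    then have int_B: "integrable (\<mu> k) (\<lambda>x. B * (1 - g x))"
      by (rule integrable_mult_right)
    \<comment> \<open>This is where invariance of \<open>\<mu> k\<close> under \<open>Sk k\<close>
      enters.\<close>
    have "integral\<^sup>L (\<mu> k) f - (\<integral>x. f (Sk k x) * g x \<partial>\<mu> k)
      = (\<integral>x. f (Sk k x) - f (Sk k x) * g x \<partial>\<mu> k)"
      using int_f int_Sk integral_invariant_measure[OF \<mu>(1) \<mu>(3) fm] by simp
    also have "\<bar>\<dots>\<bar> \<le> (\<integral>x. \<bar>f (Sk k x) - f (Sk k x) * g x\<bar> \<partial>\<mu> k)"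
      by (rule integral_abs_bound)
    also have "\<dots> \<le> (\<integral>x. B * (1 - g x) \<partial>\<mu> k)"
    proof (rule integral_mono)
      fix x
      have "\<bar>f (Sk k x) - f (Sk k x) * g x\<bar> = \<bar>f (Sk k x)\<bar> * (1 - g x)"
        using g(4)[of x] abs_mult[of "f (Sk k x)" "1 - g x"] by (simp add: algebra_simps)
      also have "\<dots> \<le> B * (1 - g x)"
        using f(2) g(4)[of x] by (intro mult_right_mono) auto
      finally show "\<bar>f (Sk k x) - f (Sk k x) * g x\<bar> \<le> B * (1 - g x)" .
    qed (use int_f int_Sk int_B in auto)
    finally show ?thesis
      by simp
  qed
  \<comment> \<open>First \<open>Sk k\<close> is exchanged for \<open>S\<close> under the same
    measure \<open>\<mu> k\<close>, then \<open>\<mu> k\<close> is sent to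
    \<open>\<nu>\<close>.\<close>
  moreover have "(\<lambda>k. \<integral>x. f (Sk k x) * g x \<partial>\<mu> k) \<longlonglongrightarrow> (\<integral>x. f (S x) * g x \<partial>\<nu>)"
    using tendsto_add[OF lim_diff lim_S] by simp
  ultimately show ?thesis
    by (intro LIMSEQ_le[OF tendsto_rabs[OF tendsto_diff[OF lim_f]] tendsto_mult_left[OF lim_g]]) auto
qed

section \<open>Removing the cutoff\<close>

text \<open>Since \<open>x\<close> has positive distance to each of the finitely many points of
  \<open>H\<close>, every factor is eventually exactly 1.\<close>

lemma cutoff_tendsto:
  assumes "finite H" "x \<notin> H"
  shows "(\<lambda>m. \<Prod>p\<in>H. min 1 (real m * dist x p)) \<longlonglongrightarrow> 1"
proof -
  have "(\<lambda>m. min 1 (real m * dist x p)) \<longlonglongrightarrow> 1" if "p \<in> H" for p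
  proof -
    have "dist x p > 0"
      using assms that by auto
    then have "filterlim (\<lambda>m. dist x p * real m) at_top sequentially"
      by (intro filterlim_tendsto_pos_mult_at_top[OF tendsto_const] filterlim_real_sequentially)
    then have "\<forall>\<^sub>F m in sequentially. 1 \<le> dist x p * real m"
      by (simp add: filterlim_at_top)
    then have "\<forall>\<^sub>F m in sequentially. min 1 (real m * dist x p) = 1"
      by eventually_elim (simp add: mult.commute)
    then show ?thesis
      by (rule tendsto_eventually)
  qed
  then have "(\<lambda>m. \<Prod>p\<in>H. min 1 (real m * dist x p)) \<longlonglongrightarrow> (\<Prod>p\<in>H. 1)"
    by (rule tendsto_prod)
  then show ?thesis
    by simp
qed

theorem theorem3p4:
  fixes S :: "circle \<Rightarrow> circle" and H :: "circle set"
    and Sk :: "nat \<Rightarrow> circle \<Rightarrow> circle"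
    and \<mu> :: "nat \<Rightarrow> circle measure" and \<mu>' :: "circle measure"
  assumes "piecewise_continuous S H"
    and "\<And>k. interval_translation_map (Sk k)"
    and "\<And>K. compact K \<Longrightarrow> K \<subseteq> - H \<Longrightarrow> uniform_limit K Sk S sequentially"
    and "\<And>k. sets (\<mu> k) = sets borel"
    and "\<And>k. prob_space (\<mu> k)"
    and "\<And>k. invariant_measure (\<mu> k) (Sk k)"
    and "sets \<mu>' = sets borel"
    and "finite_measure \<mu>'"
    and "weak_star_conv \<mu> \<mu>'"
    and "emeasure \<mu>' H = 0"
  shows "invariant_measure \<mu>' S"
proof -
  interpret finite_measure \<mu>' by fact
  have H: "finite H" and S_cont: "\<And>x. x \<notin> H \<Longrightarrow> isCont S x"
    using assms(1) by (auto simp: piecewise_continuous_def)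
  have S: "S \<in> borel_measurable borel"
    using H S_cont by (rule borel_measurable_off_finite)
  note [measurable_cong] = assms(7)
  note S [measurable]
  have "H \<in> null_sets \<mu>'"
    using assms(7,10) H by (auto intro: borel_closed finite_imp_closed)
  then have AE_H: "AE x in \<mu>'. x \<notin> H"
    by (rule AE_not_in)
  \<comment> \<open>A product over \<open>H\<close> is used instead of a truncated multiple of
    \<open>infdist x H\<close> so that the empty \<open>H\<close> is covered: the empty product is
    1, while \<open>infdist\<close> to the empty set is 0.\<close>
  define g :: "nat \<Rightarrow> circle \<Rightarrow> real" where "g m x = (\<Prod>p\<in>H. min 1 (real m * dist x p))" for m x
  have g_cont: "continuous_on UNIV (g m)" for m
    unfolding g_def by (intro continuous_intros)
  have [measurable]: "g m \<in> borel_measurable borel" for m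
    using g_cont by (rule borel_measurable_continuous_onI)
  have g0: "g m x = 0" if "x \<in> H" for m x
    unfolding g_def using H that by (intro prod_zero bexI[of _ x]) auto
  have g_nonneg: "0 \<le> g m x" and g_le: "g m x \<le> 1" for m x
    unfolding g_def by (auto intro: prod_nonneg prod_le_1)
  \<comment> \<open>On \<open>H\<close> every \<open>g m\<close> is 0, so convergence to 1 holds
    only almost everywhere; this is the role of \<open>H\<close> being a null set of
    \<open>\<mu>'\<close>.\<close>
  have g_lim: "AE x in \<mu>'. (\<lambda>m. g m x) \<longlonglongrightarrow> 1"
    using AE_H by eventually_elim (simp add: g_def cutoff_tendsto H)
  have "distr \<mu>' borel S = \<mu>'"
  proof (rule finite_borel_measure_eqI)
    show "finite_measure (distr \<mu>' borel S)"
      by (rule finite_measure_distr) measurable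
    fix f :: "circle \<Rightarrow> real"
    assume f: "continuous_on UNIV f" and "bounded (range f)"
    then obtain B where B: "\<bar>f x\<bar> \<le> B" for x
      by (auto simp: bounded_iff)
    have [measurable]: "f \<in> borel_measurable borel"
      using f by (rule borel_measurable_continuous_onI)
    have fg: "\<bar>f y * g m x\<bar> \<le> B" for m x y
      using mult_mono[OF B[of y] g_le[of m x]] g_nonneg[of m x] B[of y] by (simp add: abs_mult)
    \<comment> \<open>From here the measure is fixed and only the cutoff varies; the composition of
      \<open>f\<close> with \<open>S\<close> need not be continuous, so dominated convergence is
      used.\<close>
    have "(\<lambda>m. \<integral>x. f (S x) * g m x \<partial>\<mu>') \<longlonglongrightarrow> (\<integral>x. f (S x) \<partial>\<mu>')"
    proof (rule integral_dominated_convergence[where w = "\<lambda>_. B"])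
      show "AE x in \<mu>'. (\<lambda>m. f (S x) * g m x) \<longlonglongrightarrow> f (S x)"
        using g_lim by eventually_elim (auto intro: tendsto_eq_intros)
    qed (use fg in auto)
    then have lhs: "(\<lambda>m. \<bar>integral\<^sup>L \<mu>' f - (\<integral>x. f (S x) * g m x \<partial>\<mu>')\<bar>)
      \<longlonglongrightarrow> \<bar>integral\<^sup>L \<mu>' f - (\<integral>x. f (S x) \<partial>\<mu>')\<bar>"
      by (intro tendsto_intros)
    have "(\<lambda>m. \<integral>x. 1 - g m x \<partial>\<mu>') \<longlonglongrightarrow> (\<integral>x. 0 \<partial>\<mu>')"
    proof (rule integral_dominated_convergence[where w = "\<lambda>_. 1"])
      show "AE x in \<mu>'. (\<lambda>m. 1 - g m x) \<longlonglongrightarrow> 0"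
        using g_lim by eventually_elim (auto intro: tendsto_eq_intros)
    qed (use g_nonneg g_le in auto)
    then have rhs: "(\<lambda>m. B * (\<integral>x. 1 - g m x \<partial>\<mu>')) \<longlonglongrightarrow> 0"
      by (auto intro: tendsto_eq_intros)
    have "\<bar>integral\<^sup>L \<mu>' f - (\<integral>x. f (S x) * g m x \<partial>\<mu>')\<bar> \<le> B * (\<integral>x. 1 - g m x \<partial>\<mu>')" for m
      using S S_cont assms(3-6,9,7,8) f B g_cont g0 g_nonneg g_le by (rule cutoff_estimate)
    \<comment> \<open>The estimate is uniform in \<open>m\<close> in the sense that \<open>B\<close>
      is fixed, so its right-hand side tends to 0 with the mass missed by the cutoff.\<close>
    then have "\<bar>integral\<^sup>L \<mu>' f - (\<integral>x. f (S x) \<partial>\<mu>')\<bar> \<le> 0"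
      by (intro LIMSEQ_le[OF lhs rhs]) auto
    moreover have "integral\<^sup>L (distr \<mu>' borel S) f = (\<integral>x. f (S x) \<partial>\<mu>')"
      by (rule integral_distr) measurable
    ultimately show "integral\<^sup>L (distr \<mu>' borel S) f = integral\<^sup>L \<mu>' f"
      by simp
  qed (use assms in auto)
  then show ?thesis
    using S assms(7) by (simp add: invariant_measure_iff_distr)
qed

end
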